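(* Every graph with minor-matching hypertreewidth $k$ has sim-width at most $k$.
   Context: A tree decomposition of $G$ is a pair $(T,\mathrm{bag})$, $T$ a tree, $\mathrm{bag}: V(T)\to 2^{V(G)}$, such that every edge of $G$ lies inside some bag and for each vertex $v$ the nodes whose bags contain $v$ form a non-empty connected subtree. For $X\subseteq V(G)$, $\mu(X)$ is the maximum size of an induced matching $M$ of $G$ (the subgraph induced by the endpoints of $M$ has no edges besides $M$) such that every edge of $M$ has at least one endpoint in $X$. The minor-matching hypertreewidth of $G$ is the minimum over tree decompositions of $\max_t \mu(\mathrm{bag}(t))$. For $A\subseteq V(G)$, $\overline{A}=V(G)\setminus A$ and $\mathrm{sw}(A)$ is the maximum size of an induced matching of $G$ each of whose edges has one endpoint in $A$ and one in $\overline{A}$. A branch decomposition of $V(G)$ is $(T,\delta)$ with $T$ a tree whose internal nodes have degree 3 and $\delta$ a bijection from $V(G)$ to its leaves; each tree edge gives a bipartition $(A,\overline{A})$ of $V(G)$ with width $\mathrm{sw}(A)$; the sim-width of $G$ is the minimum over branch decompositions of the maximum edge width. *)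

theory Defs
  imports Main "HOL-Library.Extended_Nat"
begin

type_synonym 'a ugraph = "'a set \<times> 'a set set"

abbreviation verts :: "'a ugraph \<Rightarrow> 'a set" where
  "verts G \<equiv> fst G"

abbreviation edges :: "'a ugraph \<Rightarrow> 'a set set" where
  "edges G \<equiv> snd G"

definition simple_graph :: "'a ugraph \<Rightarrow> bool" where
  "simple_graph G \<longleftrightarrow> finite (verts G) \<and> (\<forall>e\<in>edges G. e \<subseteq> verts G \<and> card e = 2)"

definition induced_subgraph :: "'a ugraph \<Rightarrow> 'a set \<Rightarrow> 'a ugraph" where
  "induced_subgraph G X = (verts G \<inter> X, {e \<in> edges G. e \<subseteq> X})"

definition reachable :: "'a ugraph \<Rightarrow> 'a \<Rightarrow> 'a \<Rightarrow> bool" where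
  "reachable G u v \<longleftrightarrow> (u, v) \<in> {(x, y). {x, y} \<in> edges G}\<^sup>*"

text \<open>The null graph is not connected, so trees, and connected subtrees of a tree, are non-empty.\<close>

definition connected_graph :: "'a ugraph \<Rightarrow> bool" where
  "connected_graph G \<longleftrightarrow> verts G \<noteq> {} \<and> (\<forall>u\<in>verts G. \<forall>v\<in>verts G. reachable G u v)"

definition cycle :: "'a ugraph \<Rightarrow> 'a list \<Rightarrow> bool" where
  "cycle G p \<longleftrightarrow> 3 \<le> length p \<and> distinct p \<and>
     (\<forall>i<length p. {p ! i, p ! (Suc i mod length p)} \<in> edges G)"

definition tree :: "'a ugraph \<Rightarrow> bool" where
  "tree T \<longleftrightarrow> simple_graph T \<and> connected_graph T \<and> (\<nexists>p. cycle T p)"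

definition degree :: "'a ugraph \<Rightarrow> 'a \<Rightarrow> nat" where
  "degree G v = card {e \<in> edges G. v \<in> e}"

definition induced_matching :: "'a ugraph \<Rightarrow> 'a set set \<Rightarrow> bool" where
  "induced_matching G M \<longleftrightarrow>
     M \<subseteq> edges G \<and> pairwise disjnt M \<and> edges (induced_subgraph G (\<Union>M)) = M"

definition mu :: "'a ugraph \<Rightarrow> 'a set \<Rightarrow> nat" where
  "mu G X = Max {card M | M. induced_matching G M \<and> (\<forall>e\<in>M. e \<inter> X \<noteq> {})}"

definition tree_decomposition :: "'a ugraph \<Rightarrow> 'b ugraph \<Rightarrow> ('b \<Rightarrow> 'a set) \<Rightarrow> bool" where
  "tree_decomposition G T bag \<longleftrightarrow>
     tree T \<and>
     (\<forall>t\<in>verts T. bag t \<subseteq> verts G) \<and>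
     (\<forall>e\<in>edges G. \<exists>t\<in>verts T. e \<subseteq> bag t) \<and>
     (\<forall>v\<in>verts G. connected_graph (induced_subgraph T {t \<in> verts T. v \<in> bag t}))"

text \<open>
  Decomposition trees are finite, so nodes of type \<^typ>\<open>nat\<close> cover them all up to isomorphism.
  Widths take values in \<^typ>\<open>enat\<close>, so that the infimum over no decomposition at all
  would be infinite and not \<^term>\<open>0::nat\<close>.
\<close>

definition minor_matching_hypertreewidth :: "'a ugraph \<Rightarrow> enat" where
  "minor_matching_hypertreewidth G =
     Inf {enat (MAX t\<in>verts T. mu G (bag t)) | (T :: nat ugraph) bag. tree_decomposition G T bag}"

definition sw :: "'a ugraph \<Rightarrow> 'a set \<Rightarrow> nat" where
  "sw G A = Max {card M | M. induced_matching G M \<and>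
     (\<forall>e\<in>M. \<exists>u v. e = {u, v} \<and> u \<in> A \<and> v \<in> verts G - A)}"

text \<open>Degree 0 is admitted so that the one-node tree has a leaf and decomposes one-vertex graphs.\<close>

definition leaves :: "'a ugraph \<Rightarrow> 'a set" where
  "leaves T = {t \<in> verts T. degree T t \<le> 1}"

definition branch_decomposition :: "'a ugraph \<Rightarrow> 'b ugraph \<Rightarrow> ('a \<Rightarrow> 'b) \<Rightarrow> bool" where
  "branch_decomposition G T \<delta> \<longleftrightarrow>
     tree T \<and>
     (\<forall>t\<in>verts T - leaves T. degree T t = 3) \<and>
     bij_betw \<delta> (verts G) (leaves T)"

text \<open>The side, containing the end \<open>x\<close> of \<open>e\<close>, of the bipartition given by the tree edge \<open>e\<close>.\<close>

definition cut_side :: "'a ugraph \<Rightarrow> 'b ugraph \<Rightarrow> ('a \<Rightarrow> 'b) \<Rightarrow> 'b set \<Rightarrow> 'b \<Rightarrow> 'a set" where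
  "cut_side G T \<delta> e x = {v \<in> verts G. reachable (verts T, edges T - {e}) x (\<delta> v)}"

text \<open>
  Both sides of each bipartition are listed; they have the same \<^const>\<open>sw\<close>.
  The inserted 0 is the width of the one-node tree, which has no edges.
\<close>

definition branch_width :: "'a ugraph \<Rightarrow> 'b ugraph \<Rightarrow> ('a \<Rightarrow> 'b) \<Rightarrow> nat" where
  "branch_width G T \<delta> = Max (insert 0 {sw G (cut_side G T \<delta> e x) | e x. e \<in> edges T \<and> x \<in> e})"

text \<open>The null graph has no branch decomposition, as every tree has a leaf; its sim-width is 0.\<close>

definition sim_width :: "'a ugraph \<Rightarrow> enat" where
  "sim_width G = (if verts G = {} then 0 else
     Inf {enat (branch_width G T \<delta>) | (T :: nat ugraph) \<delta>. branch_decomposition G T \<delta>})"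

lemma sw_complement:
  assumes "A \<subseteq> verts G"
  shows "sw G (verts G - A) = sw G A"
proof -
  have "(\<exists>u v. e = {u, v} \<and> u \<in> verts G - A \<and> v \<in> verts G - (verts G - A)) \<longleftrightarrow>
        (\<exists>u v. e = {u, v} \<and> u \<in> A \<and> v \<in> verts G - A)" for e
    using assms by (auto simp: double_diff)
  then show ?thesis
    by (simp only: sw_def)
qed

end

theory Submission
  imports Defs
begin

text \<open>
  Assign every vertex \<open>v\<close> of \<open>G\<close> to a node \<open>\<tau> v\<close> whose bag contains it. If \<open>W\<close> is a union of
  components of \<open>T - t\<close>, and \<open>B\<close> a set of vertices assigned to \<open>t\<close>, then every edge of \<open>G\<close> leaving
  \<open>{v. \<tau> v \<in> W} \<union> B\<close> meets the bag of \<open>t\<close>, so the sim-width of this cut is at most \<open>\<mu> (bag t)\<close>.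
  Sets of this form can be split, down to singletons, into two smaller sets of this form: separate
  \<open>B\<close> from \<open>W\<close>, then the components of \<open>W\<close> from each other; a single component \<open>W\<close> is
  rewritten with the neighbour \<open>s\<close> of \<open>t\<close> in \<open>W\<close> in place of \<open>t\<close>. The splits form a binary tree,
  and joining the two children of its root by an edge yields the branch decomposition.
\<close>

section \<open>Cuts and induced matchings\<close>

lemma finite_edges: "simple_graph G \<Longrightarrow> finite (edges G)"
  unfolding simple_graph_def
  by (rule finite_subset[of _ "Pow (verts G)"]) auto

lemma finite_matching_sizes:
  assumes "simple_graph G"
  shows "finite {card M | M. induced_matching G M \<and> Q M}"
proof -
  have "{card M | M. induced_matching G M \<and> Q M} \<subseteq> card ` Pow (edges G)"
    by (auto simp: induced_matching_def)
  then show ?thesis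
    using finite_edges[OF assms] by (meson finite_Pow_iff finite_imageI finite_subset)
qed

lemma induced_matching_empty: "simple_graph G \<Longrightarrow> induced_matching G {}"
  by (auto simp: induced_matching_def induced_subgraph_def simple_graph_def)

text \<open>A matching across the cut consists of edges leaving \<open>A\<close>, all of which meet
  \<open>X\<close>. So every matching competing for \<open>sw G A\<close> also competes for
  \<open>mu G X\<close>.\<close>

lemma sw_le_mu:
  assumes G: "simple_graph G"
    and meets: "\<And>u v. {u, v} \<in> edges G \<Longrightarrow> u \<in> A \<Longrightarrow> v \<notin> A \<Longrightarrow> u \<in> X \<or> v \<in> X"
  shows "sw G A \<le> mu G X"
  unfolding sw_def mu_def
proof (rule Max_mono)
  show "{card M | M. induced_matching G M \<and>
      (\<forall>e\<in>M. \<exists>u v. e = {u, v} \<and> u \<in> A \<and> v \<in> verts G - A)}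
    \<subseteq> {card M | M. induced_matching G M \<and> (\<forall>e\<in>M. e \<inter> X \<noteq> {})}"
  proof clarify
    fix M assume M: "induced_matching G M"
      "\<forall>e\<in>M. \<exists>u v. e = {u, v} \<and> u \<in> A \<and> v \<in> verts G - A"
    have "e \<inter> X \<noteq> {}" if e: "e \<in> M" for e
    proof -
      obtain u v where uv: "e = {u, v}" "u \<in> A" "v \<notin> A" using bspec[OF M(2) e] by blast
      moreover have "e \<in> edges G" using M that by (auto simp: induced_matching_def)
      ultimately show ?thesis using meets[of u v] by auto
    qed
    then show "\<exists>M'. card M = card M' \<and> induced_matching G M' \<and> (\<forall>e\<in>M'. e \<inter> X \<noteq> {})"
      using M(1) by metis
  qed
  \<comment> \<open>Comparing the two maxima requires the smaller set to be non-empty; the empty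
    matching belongs to it vacuously.\<close>
  show "{card M | M. induced_matching G M \<and>
      (\<forall>e\<in>M. \<exists>u v. e = {u, v} \<and> u \<in> A \<and> v \<in> verts G - A)} \<noteq> {}"
    using induced_matching_empty[OF G] by blast
qed (rule finite_matching_sizes[OF G])

section \<open>Reachability\<close>

lemma reachable_refl: "reachable G u u"
  by (simp add: reachable_def)

lemma reachable_step: "reachable G u v \<Longrightarrow> {v, w} \<in> edges G \<Longrightarrow> reachable G u w"
  unfolding reachable_def by (rule rtrancl_into_rtrancl) auto

lemma reachable_trans: "reachable G u v \<Longrightarrow> reachable G v w \<Longrightarrow> reachable G u w"
  by (simp add: reachable_def)

lemma reachable_sym: "reachable G u v \<Longrightarrow> reachable G v u"
  unfolding reachable_def
  by (rule symD[OF sym_rtrancl]) (auto intro: symI simp: insert_commute)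

lemma reachable_induct [consumes 1, case_names refl step]:
  assumes "reachable G u v" and "P u"
    and "\<And>v w. reachable G u v \<Longrightarrow> {v, w} \<in> edges G \<Longrightarrow> P v \<Longrightarrow> P w"
  shows "P v"
  using assms(1) unfolding reachable_def
  by (induction rule: rtrancl_induct) (use assms in \<open>auto simp: reachable_def\<close>)

lemma reachable_mono: "reachable G u v \<Longrightarrow> edges G \<subseteq> edges H \<Longrightarrow> reachable H u v"
  by (induction rule: reachable_induct) (auto intro: reachable_refl reachable_step)

lemma reachable_leaves_set:
  assumes "reachable G u v" "u \<in> W" "v \<notin> W"
  obtains a b where "a \<in> W" "b \<notin> W" "{a, b} \<in> edges G"
  using assms by (induction rule: reachable_induct) auto

lemma reachable_distinct_path:
  assumes "reachable G u v"
  obtains p where "p \<noteq> []" "hd p = u" "last p = v" "distinct p"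
    "successively (\<lambda>x y. {x, y} \<in> edges G) p"
proof -
  let ?P = "\<lambda>u p. p \<noteq> [] \<and> hd p = u \<and> last p = v \<and> distinct p \<and>
    successively (\<lambda>x y. {x, y} \<in> edges G) p"
  have "\<exists>p. ?P u p"
    using assms unfolding reachable_def
  proof (induction rule: converse_rtrancl_induct)
    case base
    show ?case by (rule exI[of _ "[v]"]) simp
  next
    case (step y z)
    then obtain p where p: "?P z p" by blast
    show ?case
    proof (cases "y \<in> set p")
      case True
      \<comment> \<open>Prepending \<open>y\<close> would repeat it, so the path is cut down to its
        part from the occurrence of \<open>y\<close> on.\<close>
      then obtain p1 p2 where "p = p1 @ y # p2" by (meson split_list)
      with p have "?P y (y # p2)" by (auto simp: successively_append_iff)
      then show ?thesis by blast
    next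
      case False
      with p step(1) have "?P y (y # p)" by (auto simp: successively_Cons)
      then show ?thesis by blast
    qed
  qed
  then show ?thesis using that by blast
qed

text \<open>A path inside \<open>W\<close> from \<open>s\<close> to another neighbour
  \<open>a\<close> of \<open>t\<close> would close up through \<open>t\<close> to a cycle. So a
  component of a tree minus \<open>t\<close> contains only one neighbour of
  \<open>t\<close>.\<close>

lemma acyclic_unique_neighbour:
  assumes acyclic: "\<nexists>p. cycle T p" and "t \<notin> W"
    and sa: "reachable (induced_subgraph T W) s a" "s \<in> W"
    and adj: "{t, s} \<in> edges T" "{t, a} \<in> edges T"
  shows "s = a"
proof (rule ccontr)
  assume "s \<noteq> a"
  let ?H = "induced_subgraph T W"
  obtain p where p: "p \<noteq> []" "hd p = s" "last p = a" "distinct p"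
    and succ: "successively (\<lambda>x y. {x, y} \<in> edges ?H) p"
    using reachable_distinct_path[OF sa(1)] .
  have step: "{p ! i, p ! Suc i} \<in> edges T" "p ! Suc i \<in> W" if "Suc i < length p" for i
    using succ that by (auto simp: successively_conv_nth induced_subgraph_def)
  have "p ! i \<in> W" if "i < length p" for i
    using that p(1,2) \<open>s \<in> W\<close> step(2) by (cases i) (auto simp: hd_conv_nth)
  then have "t \<notin> set p" using \<open>t \<notin> W\<close> by (auto simp: in_set_conv_nth)
  \<comment> \<open>Adding \<open>t\<close> to these two nodes gives the three that
    \<open>cycle\<close> demands.\<close>
  moreover have "2 \<le> length p"
  proof (rule ccontr)
    assume "\<not> 2 \<le> length p"
    then have "length p = 1" using p(1) by (cases p) (auto simp: not_less_eq_eq)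
    then have "hd p = last p" by (auto simp: length_Suc_conv)
    with p \<open>s \<noteq> a\<close> show False by simp
  qed
  moreover have "{(t # p) ! i, (t # p) ! (Suc i mod length (t # p))} \<in> edges T"
    if "i < length (t # p)" for i
  proof -
    \<comment> \<open>The cases are the edge from \<open>t\<close> to \<open>s\<close>, the edges of
      \<open>p\<close>, and the closing edge from \<open>a\<close> back to \<open>t\<close>.\<close>
    have "i = 0 \<or> (\<exists>j. i = Suc j \<and> Suc j < length p) \<or> i = length p"
      using that by (cases i) auto
    then consider "i = 0" | j where "i = Suc j" "Suc j < length p" | "i = length p" by blast
    then show ?thesis
    proof cases
      case 1
      then show ?thesis using p adj by (simp add: hd_conv_nth)
    next
      case 2
      then show ?thesis using step(1)[of j] by simp
    next
      case 3
      then show ?thesis using p adj by (simp add: last_conv_nth insert_commute nth_Cons')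
    qed
  qed
  ultimately have "cycle T (t # p)" unfolding cycle_def using p(4) by auto
  with acyclic show False by blast
qed

section \<open>Hierarchical splitting of the vertex set\<close>

text \<open>A derivation is a rooted binary tree of sets, all satisfying \<open>Q\<close>, with
  singletons at its leaves. The empty set has no derivation, hence the alternative
  \<open>A = {}\<close> in the lemmas that build splittings.\<close>

inductive splittable :: "('a set \<Rightarrow> bool) \<Rightarrow> 'a set \<Rightarrow> bool" for Q where
  single: "Q {v} \<Longrightarrow> splittable Q {v}"
| join: "splittable Q A \<Longrightarrow> splittable Q B \<Longrightarrow> A \<inter> B = {} \<Longrightarrow> Q (A \<union> B) \<Longrightarrow> splittable Q (A \<union> B)"

lemma splittable_imp: "splittable Q A \<Longrightarrow> Q A"
  by (induction rule: splittable.induct)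

lemma splittable_Un:
  assumes "A = {} \<or> splittable Q A" "B = {} \<or> splittable Q B" "A \<inter> B = {}" "Q (A \<union> B)"
  shows "A \<union> B = {} \<or> splittable Q (A \<union> B)"
  using assms by (auto intro: splittable.join)

text \<open>Vertices are split off one at a time; every set that arises is a subset of
  \<open>B\<close>.\<close>

lemma splittable_hereditary:
  assumes "finite B" "\<And>A. A \<subseteq> B \<Longrightarrow> Q A"
  shows "B = {} \<or> splittable Q B"
  using assms
proof (induction rule: finite_induct)
  case (insert b B)
  have "B = {} \<or> splittable Q B" using insert.prems by (intro insert.IH) blast
  moreover have "splittable Q {b}" by (rule splittable.single[OF insert.prems]) simp
  moreover have "Q ({b} \<union> B)" by (rule insert.prems) simp
  ultimately have "{b} \<union> B = {} \<or> splittable Q ({b} \<union> B)"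
    using insert.hyps by (intro splittable_Un) auto
  then show ?case by simp
qed simp

text \<open>Some bag, at a node \<open>t'\<close>, contains both \<open>u\<close> and
  \<open>v\<close>. If \<open>u\<close> is in \<open>B\<close>, its own node is \<open>t\<close>.
  Otherwise \<open>\<tau> u\<close> is in \<open>W\<close> and \<open>\<tau> v\<close> is not, so
  the subtree of \<open>u\<close> leaves \<open>W\<close> if \<open>t'\<close> is outside
  \<open>W\<close>, and that of \<open>v\<close> does if \<open>t'\<close> is inside. A subtree can
  leave \<open>W\<close> only through \<open>t\<close>.\<close>

lemma edge_leaving_branches_meets_bag:
  assumes td: "tree_decomposition G T bag" and G: "simple_graph G"
    and \<tau>: "\<And>v. v \<in> verts G \<Longrightarrow> \<tau> v \<in> verts T \<and> v \<in> bag (\<tau> v)"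
    and closed: "\<And>x y. {x, y} \<in> edges T \<Longrightarrow> x \<in> W \<Longrightarrow> y \<notin> W \<Longrightarrow> y = t"
    and B: "\<And>v. v \<in> B \<Longrightarrow> v \<in> verts G \<and> \<tau> v = t"
    and uv: "{u, v} \<in> edges G" "u \<in> {v \<in> verts G. \<tau> v \<in> W} \<union> B" "v \<notin> {v \<in> verts G. \<tau> v \<in> W} \<union> B"
  shows "u \<in> bag t \<or> v \<in> bag t"
proof -
  have V: "u \<in> verts G" "v \<in> verts G" using G uv(1) by (auto simp: simple_graph_def)
  obtain t' where t': "t' \<in> verts T" "u \<in> bag t'" "v \<in> bag t'"
    using td uv(1) by (auto simp: tree_decomposition_def)
  have exits: "w \<in> bag t" if w: "w \<in> verts G" "x \<in> verts T" "w \<in> bag x" "y \<in> verts T" "w \<in> bag y"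
    and W: "x \<in> W" "y \<notin> W" for w x y
  proof -
    let ?H = "induced_subgraph T {t \<in> verts T. w \<in> bag t}"
    have "connected_graph ?H" using td w by (auto simp: tree_decomposition_def)
    then have xy: "reachable ?H x y"
      using w by (auto simp: connected_graph_def induced_subgraph_def)
    obtain a b where "a \<in> W" "b \<notin> W" "{a, b} \<in> edges ?H"
      using reachable_leaves_set[OF xy W] .
    then show ?thesis using closed[of a b] by (auto simp: induced_subgraph_def)
  qed
  show ?thesis
  proof (cases "u \<in> B")
    case True
    then show ?thesis using B \<tau> V by blast
  next
    case False
    then have "\<tau> u \<in> W" "\<tau> v \<notin> W" using uv V by auto
    then show ?thesis
      using exits[of u "\<tau> u" t'] exits[of v t' "\<tau> v"] V t' \<tau> by blast
  qed
qed

text \<open>Induction on \<open>card W\<close> with the pivot \<open>t\<close> and the set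
  \<open>B\<close> left free, because one step moves the pivot to a neighbour. That \<open>W\<close>
  is a union of components of \<open>T - t\<close> is encoded by letting edges leave
  \<open>W\<close> only towards \<open>t\<close>.\<close>

lemma splittable_branches:
  assumes T: "tree T" and "finite V"
    and Q: "\<And>t W B. t \<in> verts T \<Longrightarrow> W \<subseteq> verts T \<Longrightarrow> t \<notin> W \<Longrightarrow>
        (\<And>x y. {x, y} \<in> edges T \<Longrightarrow> x \<in> W \<Longrightarrow> y \<notin> W \<Longrightarrow> y = t) \<Longrightarrow>
        B \<subseteq> {v \<in> V. \<tau> v = t} \<Longrightarrow> Q ({v \<in> V. \<tau> v \<in> W} \<union> B)"
    and "t \<in> verts T" "W \<subseteq> verts T" "t \<notin> W"
    and "\<And>x y. {x, y} \<in> edges T \<Longrightarrow> x \<in> W \<Longrightarrow> y \<notin> W \<Longrightarrow> y = t"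
    and "B \<subseteq> {v \<in> V. \<tau> v = t}"
  shows "{v \<in> V. \<tau> v \<in> W} \<union> B = {} \<or> splittable Q ({v \<in> V. \<tau> v \<in> W} \<union> B)"
  using assms(4-)
proof (induction "card W" arbitrary: t W B rule: less_induct)
  case less
  let ?L = "\<lambda>W. {v \<in> V. \<tau> v \<in> W}"
  have simpT: "simple_graph T" and acyclic: "\<nexists>p. cycle T p" and connT: "connected_graph T"
    using T by (auto simp: tree_def)
  have finW: "finite W"
    using less.prems(2) simpT by (auto simp: simple_graph_def intro: finite_subset)
  have QB: "Q (?L W \<union> B)" by (rule Q) (use less.prems in auto)
  show ?case
  proof (cases "W = {}")
    case True
    have "B = {} \<or> splittable Q B"
    proof (rule splittable_hereditary)
      show "finite B" using \<open>finite V\<close> less.prems(5) by (auto intro: finite_subset)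
      show "Q A" if "A \<subseteq> B" for A
        using Q[of t "{}" A] less.prems that by auto
    qed
    then show ?thesis using True by simp
  next
    case False
    then obtain x where x: "x \<in> W" by blast
    let ?H = "induced_subgraph T W"
    \<comment> \<open>The component of \<open>x\<close> in the forest induced by \<open>W\<close>.
      If it is not all of \<open>W\<close>, it is split off, and \<open>B\<close> stays with the
      rest.\<close>
    define C where "C = {y \<in> W. reachable ?H x y}"
    have xC: "x \<in> C" using x by (simp add: C_def reachable_refl)
    have C_closed: "y \<in> C \<longleftrightarrow> z \<in> C" if "{y, z} \<in> edges T" "y \<in> W" "z \<in> W" for y z
      using that unfolding C_def
      by (auto intro: reachable_step simp: induced_subgraph_def insert_commute)
    show ?thesis
    proof (cases "C = W")
      case C: False
      have "C \<subset> W" using C by (auto simp: C_def)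
      have "W - C \<subset> W" using xC x by auto
      have 1: "?L C \<union> {} = {} \<or> splittable Q (?L C \<union> {})"
      proof (rule less.hyps)
        show "card C < card W" using \<open>C \<subset> W\<close> finW by (simp add: psubset_card_mono)
        \<comment> \<open>\<open>C\<close> is closed under edges inside \<open>W\<close>, so an edge
          leaving \<open>C\<close> also leaves \<open>W\<close> and must end in
          \<open>t\<close>.\<close>
        show "z = t" if "{y, z} \<in> edges T" "y \<in> C" "z \<notin> C" for y z
          using that C_closed[of y z] less.prems(4)[of y z] \<open>C \<subset> W\<close> by blast
      qed (use less.prems \<open>C \<subset> W\<close> in auto)
      have 2: "?L (W - C) \<union> B = {} \<or> splittable Q (?L (W - C) \<union> B)"
      proof (rule less.hyps)
        show "card (W - C) < card W" using \<open>W - C \<subset> W\<close> finW by (simp add: psubset_card_mono)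
        show "z = t" if "{y, z} \<in> edges T" "y \<in> W - C" "z \<notin> W - C" for y z
          using that C_closed[of y z] less.prems(4)[of y z] by blast
      qed (use less.prems in auto)
      have eq: "(?L C \<union> {}) \<union> (?L (W - C) \<union> B) = ?L W \<union> B" using \<open>C \<subset> W\<close> by auto
      have "(?L C \<union> {}) \<inter> (?L (W - C) \<union> B) = {}" using \<open>C \<subset> W\<close> less.prems by auto
      from splittable_Un[OF 1 2 this] show ?thesis unfolding eq using QB by blast
    next
      case C: True
      have xt: "reachable T x t"
        using connT x less.prems by (auto simp: connected_graph_def)
      \<comment> \<open>A path from \<open>W\<close> to \<open>t\<close> has to leave
        \<open>W\<close>, and the edge on which it does so ends in \<open>t\<close>. Its inner end
        \<open>s\<close> becomes the new pivot.\<close>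
      obtain s b where sb: "s \<in> W" "b \<notin> W" "{s, b} \<in> edges T"
        using reachable_leaves_set[OF xt x less.prems(3)] .
      then have st: "{t, s} \<in> edges T" using less.prems(4)[of s b] by (auto simp: insert_commute)
      let ?Bs = "{v \<in> V. \<tau> v = s}"
      \<comment> \<open>The vertices assigned to \<open>s\<close> now play the role of
        \<open>B\<close>: the set itself is unchanged while \<open>W\<close> loses a node.\<close>
      have 1: "?L (W - {s}) \<union> ?Bs = {} \<or> splittable Q (?L (W - {s}) \<union> ?Bs)"
      proof (rule less.hyps)
        show "card (W - {s}) < card W" using sb finW by (meson card_Diff1_less)
        \<comment> \<open>An edge from \<open>W - {s}\<close> to \<open>t\<close> would give
          \<open>t\<close> a second neighbour in the component \<open>W\<close>.\<close>
        show "z = s" if yz: "{y, z} \<in> edges T" "y \<in> W - {s}" "z \<notin> W - {s}" for y z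
        proof (rule ccontr)
          assume "z \<noteq> s"
          then have "z = t" using yz less.prems(4)[of y z] by auto
          have "reachable ?H x s" "reachable ?H x y" using C sb yz by (auto simp: C_def)
          then have "reachable ?H s y" by (meson reachable_sym reachable_trans)
          then have "s = y"
            using acyclic_unique_neighbour[OF acyclic less.prems(3)] sb(1) st yz(1) \<open>z = t\<close>
            by (metis insert_commute)
          with yz show False by simp
        qed
      qed (use less.prems sb in auto)
      have eqs: "?L (W - {s}) \<union> ?Bs = ?L W" using sb by auto
      \<comment> \<open>\<open>W\<close> is non-empty, so the induction hypothesis applies to
        \<open>{}\<close> and splits up \<open>B\<close> alone.\<close>
      have 2: "?L {} \<union> B = {} \<or> splittable Q (?L {} \<union> B)"
        by (rule less.hyps) (use less.prems False finW in \<open>auto simp: card_gt_0_iff\<close>)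
      show ?thesis
        using splittable_Un[of "?L W" Q B] 1 2 QB less.prems(3,5) unfolding eqs by auto
    qed
  qed
qed

section \<open>From splittings to branch decompositions\<close>

text \<open>
  Each edge \<open>e\<close> of the tree is certified by the side \<open>U\<close> of \<open>e\<close> away from the root \<open>r\<close>: that
  no other edge leaves \<open>U\<close> makes \<open>e\<close> a bridge, and hence the graph acyclic.
\<close>

definition bridged_tree :: "('b set \<Rightarrow> bool) \<Rightarrow> 'b ugraph \<Rightarrow> 'b \<Rightarrow> bool" where
  "bridged_tree P T r \<longleftrightarrow> simple_graph T \<and> r \<in> verts T \<and> (\<forall>v\<in>verts T. reachable T v r) \<and>
     (\<forall>e\<in>edges T. \<exists>U x y. e = {x, y} \<and> x \<in> U \<and> y \<notin> U \<and> r \<notin> U \<and> U \<subseteq> verts T \<and> P U \<and>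
        (\<forall>f\<in>edges T. f \<inter> U = {} \<or> f \<subseteq> U \<or> f = e))"

lemma bridged_treeE:
  assumes "bridged_tree P T r" "e \<in> edges T"
  obtains U x y where "e = {x, y}" "x \<in> U" "y \<notin> U" "r \<notin> U" "U \<subseteq> verts T" "P U"
    "\<And>a b. {a, b} \<in> edges T \<Longrightarrow> {a, b} \<noteq> e \<Longrightarrow> a \<in> U \<longleftrightarrow> b \<in> U"
proof -
  obtain U x y where *: "e = {x, y}" "x \<in> U" "y \<notin> U" "r \<notin> U" "U \<subseteq> verts T" "P U"
    and cr: "\<forall>f\<in>edges T. f \<inter> U = {} \<or> f \<subseteq> U \<or> f = e"
    using assms unfolding bridged_tree_def by metis
  have "a \<in> U \<longleftrightarrow> b \<in> U" if "{a, b} \<in> edges T" "{a, b} \<noteq> e" for a b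
    using bspec[OF cr that(1)] that(2) by auto
  with * that show ?thesis by metis
qed

lemma bridged_tree_connected:
  assumes "bridged_tree P T r" "u \<in> verts T" "v \<in> verts T"
  shows "reachable T u v"
  using assms unfolding bridged_tree_def by (meson reachable_sym reachable_trans)

text \<open>The first edge of a cycle has a side \<open>U\<close> that no other edge crosses. Going
  round the rest of the cycle from \<open>p ! 1\<close> to \<open>p ! 0\<close> then never changes
  membership in \<open>U\<close>, although these two nodes lie on different sides.\<close>

lemma bridged_tree_acyclic:
  assumes T: "bridged_tree P T r"
  shows "\<not> cycle T p"
proof
  assume c: "cycle T p"
  then have n: "3 \<le> length p" and d: "distinct p"
    and e: "\<And>i. i < length p \<Longrightarrow> {p ! i, p ! (Suc i mod length p)} \<in> edges T"
    by (auto simp: cycle_def)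
  have neq: "p ! i \<noteq> p ! j" if "i < length p" "j < length p" "i \<noteq> j" for i j
    using d that by (simp add: nth_eq_iff_index_eq)
  have "Suc 0 mod length p = 1" using n by simp
  then have e0: "{p ! 0, p ! 1} \<in> edges T" using e[of 0] n by (metis gr0I not_numeral_le_zero)
  obtain U x y where U: "{p ! 0, p ! 1} = {x, y}" "x \<in> U" "y \<notin> U"
    and cr: "\<And>a b. {a, b} \<in> edges T \<Longrightarrow> {a, b} \<noteq> {p ! 0, p ! 1} \<Longrightarrow> a \<in> U \<longleftrightarrow> b \<in> U"
    using bridged_treeE[OF T e0] by metis
  have walk: "p ! Suc i \<in> U \<longleftrightarrow> p ! 1 \<in> U" if "Suc i < length p" for i
    using that
  proof (induction i)
    case (Suc i)
    have "p ! Suc (Suc i) \<noteq> p ! 0" "p ! Suc (Suc i) \<noteq> p ! 1"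
      by (rule neq; use Suc.prems in linarith)+
    then have "{p ! Suc i, p ! Suc (Suc i)} \<noteq> {p ! 0, p ! 1}" by blast
    moreover have "{p ! Suc i, p ! Suc (Suc i)} \<in> edges T" using e[of "Suc i"] Suc.prems by simp
    ultimately show ?case using cr Suc by auto
  qed simp
  let ?m = "length p - 1"
  have "?m < length p" "Suc ?m = length p" using n by auto
  then have "?m < length p" "Suc ?m mod length p = 0" by simp_all
  then have "{p ! ?m, p ! 0} \<in> edges T" using e[of ?m] by metis
  \<comment> \<open>As the cycle has at least three nodes, the index \<open>?m\<close> is at least
    2, so the closing edge is not the first edge.\<close>
  moreover have "p ! ?m \<noteq> p ! 0" "p ! ?m \<noteq> p ! 1"
    by (rule neq; use n in linarith)+
  then have "{p ! ?m, p ! 0} \<noteq> {p ! 0, p ! 1}" by blast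
  ultimately have "p ! ?m \<in> U \<longleftrightarrow> p ! 0 \<in> U" using cr by blast
  moreover have "p ! ?m \<in> U \<longleftrightarrow> p ! 1 \<in> U" using walk[of "length p - 2"] n
    by (simp add: Suc_diff_Suc numeral_2_eq_2)
  ultimately show False using U by (auto simp: doubleton_eq_iff)
qed

lemma bridged_tree_tree:
  assumes T: "bridged_tree P T r"
  shows "tree T"
proof -
  have "simple_graph T" "r \<in> verts T" using T by (auto simp: bridged_tree_def)
  then show ?thesis
    using bridged_tree_acyclic[OF T] bridged_tree_connected[OF T]
    by (auto simp: tree_def connected_graph_def)
qed

text \<open>After its last use of the edge \<open>{x, y}\<close>, a walk goes on from
  \<open>x\<close> or \<open>y\<close> without that edge.\<close>

lemma reachable_from_edge:
  assumes "reachable T x w"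
  shows "reachable (verts T, edges T - {{x, y}}) x w \<or> reachable (verts T, edges T - {{x, y}}) y w"
  using assms
proof (induction rule: reachable_induct)
  case (step v w)
  show ?case
  proof (cases "{v, w} = {x, y}")
    case True
    then show ?thesis by (auto simp: doubleton_eq_iff intro: reachable_refl)
  next
    case False
    with step show ?thesis by (auto intro!: reachable_step[of _ _ v w])
  qed
qed (simp add: reachable_refl)

text \<open>Without \<open>e\<close> no walk crosses the border of \<open>U\<close>, yet every node
  is still reachable from an end of \<open>e\<close>. So one end reaches exactly \<open>U\<close>
  and the other exactly the remaining nodes; the two alternatives reflect which end \<open>z\<close>
  is.\<close>

lemma bridged_tree_cut_side:
  assumes T: "bridged_tree P T r" and "e \<in> edges T" "z \<in> e"
    and \<delta>: "\<And>v. v \<in> verts G \<Longrightarrow> \<delta> v \<in> verts T"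
  obtains U where "P U"
    "cut_side G T \<delta> e z = {v \<in> verts G. \<delta> v \<in> U} \<or>
     cut_side G T \<delta> e z = verts G - {v \<in> verts G. \<delta> v \<in> U}"
proof -
  obtain U x y where U: "e = {x, y}" "x \<in> U" "y \<notin> U" "U \<subseteq> verts T" "P U"
    and cr: "\<And>a b. {a, b} \<in> edges T \<Longrightarrow> {a, b} \<noteq> e \<Longrightarrow> a \<in> U \<longleftrightarrow> b \<in> U"
    using bridged_treeE[OF T assms(2)] by metis
  let ?T = "(verts T, edges T - {e})"
  have same: "a \<in> U \<longleftrightarrow> b \<in> U" if "reachable ?T a b" for a b
    using that by (induction rule: reachable_induct) (auto dest: cr)
  have x: "x \<in> verts T" using U by auto
  have xy: "reachable ?T x (\<delta> v) \<or> reachable ?T y (\<delta> v)" if "v \<in> verts G" for v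
    using reachable_from_edge bridged_tree_connected[OF T x \<delta>[OF that]] unfolding U(1) by metis
  have "reachable ?T x (\<delta> v) \<longleftrightarrow> \<delta> v \<in> U" "reachable ?T y (\<delta> v) \<longleftrightarrow> \<delta> v \<notin> U"
    if "v \<in> verts G" for v
    using xy[OF that] same[of x "\<delta> v"] same[of y "\<delta> v"] U by blast+
  then have "cut_side G T \<delta> e x = {v \<in> verts G. \<delta> v \<in> U}"
    "cut_side G T \<delta> e y = verts G - {v \<in> verts G. \<delta> v \<in> U}"
    by (auto simp: cut_side_def)
  moreover have "z = x \<or> z = y" using assms(3) U(1) by blast
  ultimately show ?thesis using that[OF U(5)] by blast
qed

section \<open>Gluing two rooted trees by a new edge\<close>

definition glue :: "'b ugraph \<Rightarrow> 'b \<Rightarrow> 'b ugraph \<Rightarrow> 'b \<Rightarrow> 'b ugraph" where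
  "glue T1 r1 T2 r2 = (verts T1 \<union> verts T2, insert {r1, r2} (edges T1 \<union> edges T2))"

lemma verts_glue [simp]: "verts (glue T1 r1 T2 r2) = verts T1 \<union> verts T2"
  by (simp add: glue_def)

lemma edges_glue [simp]: "edges (glue T1 r1 T2 r2) = insert {r1, r2} (edges T1 \<union> edges T2)"
  by (simp add: glue_def)

lemma glue_commute: "glue T1 r1 T2 r2 = glue T2 r2 T1 r1"
  by (auto simp: glue_def)

text \<open>The edge between the roots is the only new one. Nodes of the second tree are handled by
  exchanging the arguments with \<open>glue_commute\<close>.\<close>

lemma degree_glue:
  assumes "simple_graph T1" "simple_graph T2" "verts T1 \<inter> verts T2 = {}"
    "r1 \<in> verts T1" "r2 \<in> verts T2" "v \<in> verts T1"
  shows "degree (glue T1 r1 T2 r2) v = degree T1 v + (if v = r1 then 1 else 0)"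
proof -
  have "e \<subseteq> verts T1" if "e \<in> edges T1" for e
    using that assms(1) by (simp add: simple_graph_def)
  then have "{r1, r2} \<notin> edges T1" using assms(3,5) by blast
  moreover have "v \<notin> e" if "e \<in> edges T2" for e
    using that assms(2,3,6) by (auto simp: simple_graph_def)
  moreover have "{e \<in> edges (glue T1 r1 T2 r2). v \<in> e} =
      (if v = r1 then insert {r1, r2} {e \<in> edges T1. v \<in> e} else {e \<in> edges T1. v \<in> e})"
    using assms(3,5,6) calculation by auto
  ultimately show ?thesis
    using finite_edges[OF assms(1)] by (simp add: degree_def)
qed

lemma bridged_tree_single: "bridged_tree P ({a}, {}) a"
  by (auto simp: bridged_tree_def simple_graph_def reachable_refl)

text \<open>The root of \<open>T2\<close> remains the root, and \<open>verts T1\<close> certifies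
  the new edge. Old edges keep their sides: these avoid the root of their own tree and the whole
  other tree, so the new edge does not touch them.\<close>

lemma bridged_tree_glue:
  assumes T1: "bridged_tree P T1 r1" and T2: "bridged_tree P T2 r2"
    and disj: "verts T1 \<inter> verts T2 = {}" and P: "P (verts T1)"
  shows "bridged_tree P (glue T1 r1 T2 r2) r2"
proof -
  let ?T = "glue T1 r1 T2 r2"
  have r: "r1 \<in> verts T1" "r2 \<in> verts T2" "r1 \<notin> verts T2" "r2 \<notin> verts T1"
    and s: "simple_graph T1" "simple_graph T2"
    using T1 T2 disj by (auto simp: bridged_tree_def)
  have sub: "e \<subseteq> verts T1" if "e \<in> edges T1" for e using s that by (auto simp: simple_graph_def)
  have sub2: "e \<subseteq> verts T2" if "e \<in> edges T2" for e using s that by (auto simp: simple_graph_def)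
  have "r1 \<noteq> r2" using r by auto
  then have "simple_graph ?T" using s r by (auto simp: simple_graph_def)
  moreover have "reachable ?T v r2" if "v \<in> verts ?T" for v
  proof -
    have "reachable ?T v r1 \<or> reachable ?T v r2"
      using that bridged_tree_connected[OF T1 _ r(1)] bridged_tree_connected[OF T2 _ r(2)]
        reachable_mono[of T1 v r1 ?T] reachable_mono[of T2 v r2 ?T] by auto
    then show ?thesis using reachable_step[of ?T v r1 r2] by auto
  qed
  moreover have "\<exists>U x y. e = {x, y} \<and> x \<in> U \<and> y \<notin> U \<and> r2 \<notin> U \<and> U \<subseteq> verts ?T \<and> P U \<and>
        (\<forall>f\<in>edges ?T. f \<inter> U = {} \<or> f \<subseteq> U \<or> f = e)" if "e \<in> edges ?T" for e
  proof -
    have "e = {r1, r2} \<or> e \<in> edges T1 \<or> e \<in> edges T2" using that by simp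
    then consider "e = {r1, r2}" | "e \<in> edges T1" | "e \<in> edges T2" by blast
    then show ?thesis
    proof cases
      case 1
      show ?thesis
        by (intro exI[of _ "verts T1"] exI[of _ r1] exI[of _ r2]) (use 1 r P sub sub2 disj in auto)
    next
      case 2
      then obtain U x y where U: "e = {x, y}" "x \<in> U" "y \<notin> U" "r1 \<notin> U" "U \<subseteq> verts T1" "P U"
        and cr: "\<forall>f\<in>edges T1. f \<inter> U = {} \<or> f \<subseteq> U \<or> f = e"
        using T1 unfolding bridged_tree_def by metis
      have "f \<inter> U = {} \<or> f \<subseteq> U \<or> f = e" if "f \<in> edges ?T" for f
      proof -
        consider "f = {r1, r2}" | "f \<in> edges T1" | "f \<in> edges T2" using \<open>f \<in> edges ?T\<close> by auto
        then show ?thesis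
        proof cases
          assume "f = {r1, r2}"
          then show ?thesis using U(4,5) r(4) by blast
        next
          assume "f \<in> edges T1"
          then show ?thesis using cr by blast
        next
          assume "f \<in> edges T2"
          then show ?thesis using sub2[of f] U(5) disj by blast
        qed
      qed
      then have "\<forall>f\<in>edges ?T. f \<inter> U = {} \<or> f \<subseteq> U \<or> f = e" ..
      moreover have "r2 \<notin> U" "U \<subseteq> verts ?T" using U r(4) by auto
      ultimately show ?thesis using U(1,2,3,6) by (intro exI[of _ U] exI[of _ x] exI[of _ y] conjI)
    next
      case 3
      then obtain U x y where U: "e = {x, y}" "x \<in> U" "y \<notin> U" "r2 \<notin> U" "U \<subseteq> verts T2" "P U"
        and cr: "\<forall>f\<in>edges T2. f \<inter> U = {} \<or> f \<subseteq> U \<or> f = e"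
        using T2 unfolding bridged_tree_def by metis
      have "f \<inter> U = {} \<or> f \<subseteq> U \<or> f = e" if "f \<in> edges ?T" for f
      proof -
        consider "f = {r1, r2}" | "f \<in> edges T1" | "f \<in> edges T2" using \<open>f \<in> edges ?T\<close> by auto
        then show ?thesis
        proof cases
          assume "f = {r1, r2}"
          then show ?thesis using U(4,5) r(3) by blast
        next
          assume "f \<in> edges T2"
          then show ?thesis using cr by blast
        next
          assume "f \<in> edges T1"
          then show ?thesis using sub[of f] U(5) disj by blast
        qed
      qed
      then have "\<forall>f\<in>edges ?T. f \<inter> U = {} \<or> f \<subseteq> U \<or> f = e" ..
      moreover have "U \<subseteq> verts ?T" using U by auto
      ultimately show ?thesis using U(1-4,6) by (intro exI[of _ U] exI[of _ x] exI[of _ y] conjI)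
    qed
  qed
  ultimately show ?thesis using r by (auto simp: bridged_tree_def)
qed

section \<open>Turning a splitting into a cubic tree\<close>

lemma inj_on_preimage_Int:
  assumes "inj_on f V" "A \<subseteq> V" "S \<inter> X = f ` A" "f ` V \<subseteq> X"
  shows "{v \<in> V. f v \<in> S} = A"
proof -
  have "f v \<in> S \<longleftrightarrow> f v \<in> f ` A" if "v \<in> V" for v using assms(3,4) that by blast
  then show ?thesis using assms(1,2) by (auto simp: inj_on_image_mem_iff)
qed

text \<open>A common node would be the image of an element of \<open>B\<close>, hence lie in
  \<open>X\<close>, hence be the image of an element of \<open>A\<close> as well, against
  injectivity.\<close>

lemma disjoint_outside_image:
  assumes "inj_on f V" "A \<subseteq> V" "B \<subseteq> V" "A \<inter> B = {}"
    and S: "S \<inter> X = f ` A" "S' \<inter> (X \<union> S) = f ` B" "f ` V \<subseteq> X"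
  shows "S \<inter> S' = {}"
proof -
  have "v \<in> f ` A \<inter> f ` B" if "v \<in> S" "v \<in> S'" for v
  proof -
    have v: "v \<in> f ` B" unfolding S(2)[symmetric] using that by simp
    then have "v \<in> S \<inter> X" using that \<open>B \<subseteq> V\<close> S(3) by blast
    then show ?thesis using v unfolding S(1) by simp
  qed
  moreover have "f ` A \<inter> f ` B = {}"
    using inj_on_image_Int[OF assms(1-3)] assms(4) by simp
  ultimately show ?thesis by blast
qed

text \<open>
  The root counts with one additional edge, which attaches it to the rest of the decomposition.
  All inner nodes are chosen outside \<open>X\<close>, so that trees built separately stay disjoint.
\<close>

lemma splittable_bridged_tree:
  fixes \<delta> :: "'a \<Rightarrow> nat"
  assumes "splittable Q A" "A \<subseteq> V" "inj_on \<delta> V" "finite X" "\<delta> ` V \<subseteq> X"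
  shows "\<exists>T r. bridged_tree (\<lambda>U. Q {v \<in> V. \<delta> v \<in> U}) T r \<and> verts T \<inter> X = \<delta> ` A \<and>
    (\<forall>v\<in>verts T. degree T v + (if v = r then 1 else 0) = (if v \<in> \<delta> ` V then 1 else 3))"
  using assms
proof (induction arbitrary: X rule: splittable.induct)
  case (single v)
  show ?case
    by (intro exI[of _ "({\<delta> v}, {})"] exI[of _ "\<delta> v"])
      (use single bridged_tree_single in \<open>auto simp: degree_def\<close>)
next
  case (join A B)
  let ?P = "\<lambda>U. Q {v \<in> V. \<delta> v \<in> U}"
  let ?D = "\<lambda>v. if v \<in> \<delta> ` V then 1 else 3 :: nat"
  obtain T1 r1 where T1: "bridged_tree ?P T1 r1" and X1: "verts T1 \<inter> X = \<delta> ` A"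
    and d1: "\<And>v. v \<in> verts T1 \<Longrightarrow> degree T1 v + (if v = r1 then 1 else 0) = ?D v"
    using join.IH(1)[of X] join.prems by auto
  have B: "B \<subseteq> V" and inj: "inj_on \<delta> V" and VX': "\<delta> ` V \<subseteq> X \<union> verts T1"
    using join.prems by auto
  \<comment> \<open>Enlarging \<open>X\<close> by the nodes of \<open>T1\<close> keeps the inner
    nodes of the second tree away from the first tree.\<close>
  have "finite (X \<union> verts T1)" using T1 join.prems by (auto simp: bridged_tree_def simple_graph_def)
  from join.IH(2)[OF B inj this VX']
  obtain T2 r2 where T2: "bridged_tree ?P T2 r2"
    and X2: "verts T2 \<inter> (X \<union> verts T1) = \<delta> ` B"
    and d2: "\<And>v. v \<in> verts T2 \<Longrightarrow> degree T2 v + (if v = r2 then 1 else 0) = ?D v"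
    by auto
  have s: "simple_graph T1" "simple_graph T2" and r: "r1 \<in> verts T1" "r2 \<in> verts T2"
    using T1 T2 by (auto simp: bridged_tree_def)
  have "finite (X \<union> verts T1 \<union> verts T2)"
    using s join.prems by (auto simp: simple_graph_def)
  then obtain p where p: "p \<notin> X" "p \<notin> verts T1" "p \<notin> verts T2"
    using ex_new_if_finite[OF infinite_UNIV_nat] by (metis UnCI)
  have disj: "verts T1 \<inter> verts T2 = {}"
    by (rule disjoint_outside_image[OF inj _ B join.hyps(3) X1 X2]) (use join.prems in auto)
  \<comment> \<open>\<open>X\<close> contains the names of all vertices, so the vertices whose
    leaves lie in \<open>T1\<close> are exactly those of \<open>A\<close>.\<close>
  have PA: "?P (verts T1)"
  proof -
    have "{v \<in> V. \<delta> v \<in> verts T1} = A"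
      by (rule inj_on_preimage_Int[OF _ _ X1]) (use join.prems in auto)
    then show ?thesis using splittable_imp[OF join.hyps(1)] by simp
  qed
  have PB: "?P (verts T2)"
  proof -
    have "\<delta> ` B \<subseteq> X" using B join.prems by blast
    then have "verts T2 \<inter> X = \<delta> ` B" using X2 by blast
    then have "{v \<in> V. \<delta> v \<in> verts T2} = B"
      by (rule inj_on_preimage_Int[rotated 2]) (use join.prems in auto)
    then show ?thesis using splittable_imp[OF join.hyps(2)] by simp
  qed
  \<comment> \<open>Both subtrees are hung on the fresh node \<open>p\<close>, which is the second
    root in each \<open>glue\<close> and so remains the root.\<close>
  define T0 where "T0 = ({p}, {} :: nat set set)"
  have T0: "bridged_tree ?P T0 p" unfolding T0_def by (rule bridged_tree_single)
  have v0: "verts T0 = {p}" by (simp add: T0_def)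
  define T' where "T' = glue T1 r1 T0 p"
  define T where "T = glue T2 r2 T' p"
  have T': "bridged_tree ?P T' p"
    unfolding T'_def using p PA T1 T0 by (intro bridged_tree_glue) (auto simp: v0)
  have vT': "verts T' = insert p (verts T1)" by (auto simp: T'_def v0)
  have disj': "verts T2 \<inter> verts T' = {}" using disj p by (auto simp: vT')
  have T: "bridged_tree ?P T p"
    unfolding T_def using disj' PB T2 T' by (intro bridged_tree_glue)
  have vT: "verts T = insert p (verts T1 \<union> verts T2)" by (auto simp: T_def vT')
  have s': "simple_graph T'" "simple_graph T0" using T' T0 by (auto simp: bridged_tree_def)
  have d': "degree T v = degree T' v + (if v = p then 1 else 0)" if "v \<in> verts T'" for v
    unfolding T_def glue_commute[of T2] using that disj' r s s'
    by (intro degree_glue) (auto simp: vT')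
  have "degree T v + (if v = p then 1 else 0) = ?D v" if "v \<in> verts T" for v
  proof -
    have "v = p \<or> v \<in> verts T1 \<or> v \<in> verts T2" using that vT by simp
    then consider "v = p" | "v \<in> verts T1" | "v \<in> verts T2" by blast
    then show ?thesis
    proof cases
      \<comment> \<open>\<open>p\<close> has one edge to each subtree; the edge counted in advance
        for the root makes three.\<close>
      case 1
      have "degree T' p = degree T0 p + 1"
        unfolding T'_def glue_commute[of T1] using p r s s'
        by (subst degree_glue) (auto simp: v0)
      moreover have "degree T0 p = 0" by (simp add: T0_def degree_def)
      moreover have "p \<notin> \<delta> ` V" using p join.prems by auto
      ultimately show ?thesis using 1 d'[of p] vT' by auto
    next
      case 2
      have "degree T' v = degree T1 v + (if v = r1 then 1 else 0)"
        unfolding T'_def using 2 p r s s' by (intro degree_glue) (auto simp: v0)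
      then show ?thesis using 2 d1[of v] d'[of v] vT' p by auto
    next
      case 3
      have "degree T v = degree T2 v + (if v = r2 then 1 else 0)"
        unfolding T_def using 3 disj' r s s' by (intro degree_glue) (auto simp: vT')
      then show ?thesis using 3 d2[of v] p by auto
    qed
  qed
  moreover have "verts T \<inter> X = \<delta> ` (A \<union> B)"
  proof -
    have "\<delta> ` B \<subseteq> X" using B join.prems by blast
    then have "verts T2 \<inter> X = \<delta> ` B" using X2 by blast
    then show ?thesis using X1 p(1) unfolding vT by (simp add: Int_Un_distrib2 image_Un)
  qed
  ultimately show ?case using T by blast
qed

text \<open>The topmost split gets no node of its own, as that node would have degree 2. Its two
  subtrees are joined directly, and the joining edge is the additional edge already counted at both
  roots.\<close>

lemma splittable_branch_decomposition:
  fixes G :: "'a ugraph"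
  assumes "splittable Q (verts G)" "finite (verts G)"
  obtains T :: "nat ugraph" and \<delta> r where
    "branch_decomposition G T \<delta>" "bridged_tree (\<lambda>U. Q {v \<in> verts G. \<delta> v \<in> U}) T r"
proof -
  let ?V = "verts G"
  obtain \<delta> :: "'a \<Rightarrow> nat" where inj: "inj_on \<delta> ?V"
    using finite_imp_inj_to_nat_seg[OF assms(2)] by blast
  let ?P = "\<lambda>U. Q {v \<in> ?V. \<delta> v \<in> U}"
  \<comment> \<open>The bound \<open>degree T v \<le> 1\<close> leaves room for the one-node tree,
    whose leaf has degree 0.\<close>
  have "\<exists>T r. bridged_tree ?P T r \<and> verts T \<inter> \<delta> ` ?V = \<delta> ` ?V \<and>
    (\<forall>v\<in>verts T. if v \<in> \<delta> ` ?V then degree T v \<le> 1 else degree T v = 3)"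
    using assms(1)
  proof cases
    case (single v)
    then show ?thesis
      by (intro exI[of _ "({\<delta> v}, {})"] exI[of _ "\<delta> v"])
        (use bridged_tree_single in \<open>auto simp: degree_def\<close>)
  next
    case (join A B)
    let ?D = "\<lambda>v. if v \<in> \<delta> ` ?V then 1 else 3 :: nat"
    have AB: "A \<subseteq> ?V" "B \<subseteq> ?V" using join by auto
    obtain T1 r1 where T1: "bridged_tree ?P T1 r1" and X1: "verts T1 \<inter> \<delta> ` ?V = \<delta> ` A"
      and d1: "\<And>v. v \<in> verts T1 \<Longrightarrow> degree T1 v + (if v = r1 then 1 else 0) = ?D v"
      using splittable_bridged_tree[OF join(2) AB(1) inj, of "\<delta> ` ?V"] assms(2) by auto
    have "finite (\<delta> ` ?V \<union> verts T1)"
      using T1 assms(2) by (auto simp: bridged_tree_def simple_graph_def)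
    from splittable_bridged_tree[OF join(3) AB(2) inj this Un_upper1]
    obtain T2 r2 where T2: "bridged_tree ?P T2 r2"
      and X2: "verts T2 \<inter> (\<delta> ` ?V \<union> verts T1) = \<delta> ` B"
      and d2: "\<And>v. v \<in> verts T2 \<Longrightarrow> degree T2 v + (if v = r2 then 1 else 0) = ?D v"
      by auto
    have s: "simple_graph T1" "simple_graph T2" and r: "r1 \<in> verts T1" "r2 \<in> verts T2"
      using T1 T2 by (auto simp: bridged_tree_def)
    have disj: "verts T1 \<inter> verts T2 = {}"
      by (rule disjoint_outside_image[OF inj AB join(4) X1 X2 subset_refl])
    have "{v \<in> ?V. \<delta> v \<in> verts T1} = A"
      by (rule inj_on_preimage_Int[OF inj AB(1) X1]) simp
    then have T: "bridged_tree ?P (glue T1 r1 T2 r2) r2"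
      using splittable_imp[OF join(2)] T1 T2 disj by (intro bridged_tree_glue) auto
    have "degree (glue T1 r1 T2 r2) v = ?D v" if "v \<in> verts T1 \<union> verts T2" for v
    proof (cases "v \<in> verts T1")
      case True
      then show ?thesis using degree_glue[OF s disj r True] d1[of v] by simp
    next
      case False
      then have v: "v \<in> verts T2" using that by simp
      have "verts T2 \<inter> verts T1 = {}" using disj by auto
      then show ?thesis
        using degree_glue[OF s(2,1) _ r(2,1) v] d2[OF v] glue_commute[of T1 r1] by simp
    qed
    moreover have "verts (glue T1 r1 T2 r2) \<inter> \<delta> ` ?V = \<delta> ` ?V"
      using X1 X2 AB join(1) by auto
    ultimately show ?thesis using T
      by (intro exI[of _ "glue T1 r1 T2 r2"] exI[of _ r2]) auto
  qed
  then obtain T r where T: "bridged_tree ?P T r" "verts T \<inter> \<delta> ` ?V = \<delta> ` ?V"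
    and d: "\<forall>v\<in>verts T. if v \<in> \<delta> ` ?V then degree T v \<le> 1 else degree T v = 3"
    by (elim exE conjE)
  have "leaves T = \<delta> ` ?V"
    using T(2) d by (fastforce simp: leaves_def split: if_splits)
  moreover have "\<forall>t\<in>verts T - \<delta> ` ?V. degree T t = 3" using d by auto
  ultimately have "branch_decomposition G T \<delta>"
    using bridged_tree_tree[OF T(1)] inj
    by (simp add: branch_decomposition_def bij_betw_def)
  then show ?thesis using that T(1) by blast
qed

section \<open>Comparison of the two widths\<close>

lemma sim_width_le_if_splittable:
  assumes G: "simple_graph G" and split: "splittable (\<lambda>A. sw G A \<le> k) (verts G)"
  shows "sim_width G \<le> enat k"
proof -
  have fin: "finite (verts G)" using G by (simp add: simple_graph_def)
  obtain T :: "nat ugraph" and \<delta> r where bd: "branch_decomposition G T \<delta>"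
    and T: "bridged_tree (\<lambda>U. sw G {v \<in> verts G. \<delta> v \<in> U} \<le> k) T r"
    using splittable_branch_decomposition[OF split fin] .
  have \<delta>: "\<delta> v \<in> verts T" if "v \<in> verts G" for v
    using bd that by (auto simp: branch_decomposition_def bij_betw_def leaves_def)
  \<comment> \<open>Up to complement, which preserves \<open>sw\<close>, each side of a tree edge is
    the preimage of the set that certifies the edge.\<close>
  have le: "sw G (cut_side G T \<delta> e x) \<le> k" if ex: "e \<in> edges T" "x \<in> e" for e x
  proof -
    obtain U where U: "sw G {v \<in> verts G. \<delta> v \<in> U} \<le> k"
      and "cut_side G T \<delta> e x = {v \<in> verts G. \<delta> v \<in> U} \<or>
        cut_side G T \<delta> e x = verts G - {v \<in> verts G. \<delta> v \<in> U}"
      using bridged_tree_cut_side[OF T ex, where G = G and \<delta> = \<delta>] \<delta> by blast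
    moreover have "sw G (verts G - {v \<in> verts G. \<delta> v \<in> U}) = sw G {v \<in> verts G. \<delta> v \<in> U}"
      by (rule sw_complement) auto
    ultimately show ?thesis by auto
  qed
  \<comment> \<open>The bound \<open>k\<close> on all listed widths already makes the set finite, as
    bounding its \<open>Max\<close> requires.\<close>
  have "finite {sw G (cut_side G T \<delta> e x) | e x. e \<in> edges T \<and> x \<in> e}"
    by (rule finite_subset[of _ "{..k}"]) (use le in auto)
  then have "branch_width G T \<delta> \<le> k"
    unfolding branch_width_def using le by (subst Max_le_iff) auto
  moreover have "sim_width G \<le> enat (branch_width G T \<delta>)"
  proof (cases "verts G = {}")
    case False
    then have "sim_width G = Inf {enat (branch_width G T \<delta>) | (T :: nat ugraph) \<delta>.
      branch_decomposition G T \<delta>}" by (simp add: sim_width_def)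
    also have "\<dots> \<le> enat (branch_width G T \<delta>)" using bd by (intro Inf_lower) blast
    finally show ?thesis .
  qed (simp add: sim_width_def)
  ultimately show ?thesis by (meson enat_ord_simps(1) order_trans)
qed

text \<open>\<open>enat\<close> is well-ordered, so the infimum of a non-empty set is attained; the
  set is non-empty because the infimum of the empty set is infinite.\<close>

lemma minor_matching_hypertreewidth_attained:
  fixes G :: "'a ugraph"
  assumes "minor_matching_hypertreewidth G = enat k"
  obtains T :: "nat ugraph" and bag where "tree_decomposition G T bag"
    "\<And>t. t \<in> verts T \<Longrightarrow> mu G (bag t) \<le> k"
proof -
  let ?S = "{enat (MAX t\<in>verts T. mu G (bag t)) | (T :: nat ugraph) bag. tree_decomposition G T bag}"
  have "Inf ?S = enat k" using assms by (simp add: minor_matching_hypertreewidth_def)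
  moreover have "?S \<noteq> {}"
    using \<open>Inf ?S = enat k\<close> by (metis Inf_empty enat.distinct(1) top_enat_def)
  ultimately have "enat k \<in> ?S" using wellorder_InfI[of _ ?S] by fastforce
  then obtain T :: "nat ugraph" and bag where td: "tree_decomposition G T bag"
    and k: "k = (MAX t\<in>verts T. mu G (bag t))" by auto
  have "finite (verts T)" using td by (auto simp: tree_decomposition_def tree_def simple_graph_def)
  then show ?thesis using that[OF td] k by simp
qed

theorem theorem9:
  fixes G :: "'a ugraph" and k :: nat
  assumes "simple_graph G"
    and "minor_matching_hypertreewidth G = enat k"
  shows "sim_width G \<le> enat k"
proof (cases "verts G = {}")
  case True
  then show ?thesis by (simp add: sim_width_def)
next
  case False
  let ?V = "verts G"
  obtain T :: "nat ugraph" and bag where td: "tree_decomposition G T bag"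
    and mu: "\<And>t. t \<in> verts T \<Longrightarrow> mu G (bag t) \<le> k"
    using minor_matching_hypertreewidth_attained[OF assms(2)] by blast
  have tree: "tree T" using td by (simp add: tree_decomposition_def)
  \<comment> \<open>Connected graphs are non-empty by definition, so the subtree of each vertex has
    a node.\<close>
  have "\<forall>v\<in>?V. \<exists>t\<in>verts T. v \<in> bag t"
    using td by (fastforce simp: tree_decomposition_def connected_graph_def induced_subgraph_def)
  then obtain \<tau> where \<tau>: "\<And>v. v \<in> ?V \<Longrightarrow> \<tau> v \<in> verts T \<and> v \<in> bag (\<tau> v)" by metis
  obtain t where t: "t \<in> verts T" using tree by (auto simp: tree_def connected_graph_def)
  \<comment> \<open>Any node may serve as first pivot: with all other nodes in \<open>?W\<close> and
    all vertices assigned to \<open>t\<close> in \<open>?B\<close>, the set to be split is the whole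
    of \<open>?V\<close>.\<close>
  let ?W = "verts T - {t}" and ?B = "{v \<in> ?V. \<tau> v = t}"
  have "{v \<in> ?V. \<tau> v \<in> ?W} \<union> ?B = {} \<or>
      splittable (\<lambda>A. sw G A \<le> k) ({v \<in> ?V. \<tau> v \<in> ?W} \<union> ?B)"
  proof (rule splittable_branches[OF tree])
    show "finite ?V" using assms(1) by (simp add: simple_graph_def)
    show "sw G ({v \<in> ?V. \<tau> v \<in> W} \<union> B) \<le> k"
      if "s \<in> verts T" and closed: "\<And>x y. {x, y} \<in> edges T \<Longrightarrow> x \<in> W \<Longrightarrow> y \<notin> W \<Longrightarrow> y = s"
        and B: "B \<subseteq> {v \<in> ?V. \<tau> v = s}" for s W B
    proof -
      have B': "v \<in> ?V \<and> \<tau> v = s" if "v \<in> B" for v using B that by blast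
      have "sw G ({v \<in> ?V. \<tau> v \<in> W} \<union> B) \<le> mu G (bag s)"
        by (rule sw_le_mu[OF assms(1)])
          (rule edge_leaving_branches_meets_bag[OF td assms(1) \<tau> closed B'])
      then show ?thesis using mu[OF that(1)] by simp
    qed
    show "y = t" if "{x, y} \<in> edges T" "x \<in> ?W" "y \<notin> ?W" for x y
      using that tree by (auto simp: tree_def simple_graph_def)
  qed (use t in auto)
  moreover have "{v \<in> ?V. \<tau> v \<in> ?W} \<union> ?B = ?V" using \<tau> by auto
  ultimately have "splittable (\<lambda>A. sw G A \<le> k) ?V" using False by metis
  then show ?thesis by (rule sim_width_le_if_splittable[OF assms(1)])
qed

end
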